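(* Let $n,k,l,r$ be integers with $k,r\geq 2$ and $n\geq l\geq t+1$, where $t=t(k,r)$. Every hypergraph in $MSH(n;k,l,r)$ is $(k,l)$-edge-maximal.
   Context: A hypergraph $H=(V,E)$ has a finite vertex set $V$ and a set $E$ of nonempty subsets of $V$ (edges); it is $r$-uniform if every edge has exactly $r$ elements. $K_m^r$ denotes the complete $r$-uniform hypergraph on $m$ vertices (all $r$-subsets are edges; no edges if $m<r$), and $K_1$ is a single vertex. A subhypergraph $H'=(V',E')$ of $H$ has $V'\subseteq V$, $E'\subseteq E$ (with each edge of $E'$ contained in $V'$). For $X\subseteq V$, $d_H(X)$ is the number of edges meeting both $X$ and $V\setminus X$; $\kappa'(H)=\min\{d_H(X):\emptyset\neq X\subsetneq V\}$. For an $r$-subset $e\notin E$ of $V$, $H+e=(V,E\cup\{e\})$. An $r$-uniform hypergraph $H$ is $(k,l)$-edge-maximal if every subhypergraph $H'$ with $|V(H')|\geq l$ has $\kappa'(H')\leq k$, but for every $r$-subset $e$ of $V(H)$ not in $E(H)$, $H+e$ has a subhypergraph $H''$ with $|V(H'')|\geq l$ and $\kappa'(H'')\geq k+1$. Binomial coefficients are $0$ when the lower index exceeds the upper. For $k,r\geq2$, $t=t(k,r)$ is the integer with $\binom{t-1}{r-1}\leq k<\binom{t}{r-1}$, and $s=s(k,r)$ is the largest integer with $k+\binom{s}{r}\leq ks$. Star-like-$(k,l)$ $r$-uniform hypergraphs: start with a copy of $K_{l-1}^r$ (the nucleus); attach to it any number of vertex-disjoint satellites, each satellite being either a single vertex $K_1$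 or a copy of $K_i^r$ with $r\leq i\leq l-1$, where each satellite is attached by adding exactly $k$ new edges, each an $r$-subset of the union of the satellite's and the nucleus's vertex sets meeting both. $MSH(n;k,l,r)$: write $n=p(l-1)+q$ with $0\leq q<l-1$. (i) If $l-1>s$: the star-like-$(k,l)$ hypergraphs whose nucleus and $p-1$ satellites are copies of $K_{l-1}^r$, together with, if $q>s$, one additional satellite $K_q^r$, and if $q\leq s$, $q$ additional satellites $K_1$, each attached by $k$ edges. (ii) If $l-1\leq s$: the nucleus is $K_{l-1}^r$ and there are $n-(l-1)$ satellites $K_1$, each attached to the nucleus by $k$ edges. *)

theory Defs
  imports Main "HOL-Library.Multiset" "HOL-Library.Disjoint_Sets"
begin

record 'a hypergraph =
  verts :: "'a set"
  edges :: "'a set set"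

definition hypergraph :: "'a hypergraph \<Rightarrow> bool" where
  "hypergraph H \<longleftrightarrow> finite (verts H) \<and> (\<forall>e\<in>edges H. e \<noteq> {} \<and> e \<subseteq> verts H)"

definition uniform :: "nat \<Rightarrow> 'a hypergraph \<Rightarrow> bool" where
  "uniform r H \<longleftrightarrow> (\<forall>e\<in>edges H. card e = r)"

definition subhypergraph :: "'a hypergraph \<Rightarrow> 'a hypergraph \<Rightarrow> bool" where
  "subhypergraph H' H \<longleftrightarrow>
     hypergraph H' \<and> verts H' \<subseteq> verts H \<and> edges H' \<subseteq> edges H"

definition add_edge :: "'a hypergraph \<Rightarrow> 'a set \<Rightarrow> 'a hypergraph" where
  "add_edge H e = H\<lparr>edges := insert e (edges H)\<rparr>"

definition cut_degree :: "'a hypergraph \<Rightarrow> 'a set \<Rightarrow> nat" where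
  "cut_degree H X = card {e \<in> edges H. e \<inter> X \<noteq> {} \<and> e \<inter> (verts H - X) \<noteq> {}}"

text \<open>The edge-connectivity. On fewer than two vertices the minimum is over the empty set,
  and its value is unspecified.\<close>

definition edge_conn :: "'a hypergraph \<Rightarrow> nat" where
  "edge_conn H = Min (cut_degree H ` {X. X \<noteq> {} \<and> X \<subset> verts H})"

definition edge_maximal :: "nat \<Rightarrow> nat \<Rightarrow> nat \<Rightarrow> 'a hypergraph \<Rightarrow> bool" where
  "edge_maximal k l r H \<longleftrightarrow>
     hypergraph H \<and> uniform r H \<and>
     (\<forall>H'. subhypergraph H' H \<and> card (verts H') \<ge> l \<longrightarrow> edge_conn H' \<le> k) \<and>
     (\<forall>e. e \<subseteq> verts H \<and> card e = r \<and> e \<notin> edges H \<longrightarrow>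
        (\<exists>H''. subhypergraph H'' (add_edge H e) \<and> card (verts H'') \<ge> l \<and>
               edge_conn H'' \<ge> k + 1))"

text \<open>For \<open>k, r \<ge> 2\<close> the two numbers below are well defined: \<open>m choose (r - 1)\<close> is
  nondecreasing and unbounded in \<open>m\<close>, so exactly one \<open>t\<close> qualifies (and it is positive, so
  \<open>t - 1\<close> is not truncated); \<open>s = 1\<close> satisfies the inequality, and large \<open>s\<close> do not.\<close>

definition t_num :: "nat \<Rightarrow> nat \<Rightarrow> nat" where
  "t_num k r = (THE t. ((t - 1) choose (r - 1)) \<le> k \<and> k < (t choose (r - 1)))"

definition s_num :: "nat \<Rightarrow> nat \<Rightarrow> nat" where
  "s_num k r = (GREATEST s. k + (s choose r) \<le> k * s)"

definition complete_edges :: "nat \<Rightarrow> 'a set \<Rightarrow> 'a set set" where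
  "complete_edges r V = {e. e \<subseteq> V \<and> card e = r}"

definition crossing_edges :: "nat \<Rightarrow> 'a set \<Rightarrow> 'a set \<Rightarrow> 'a set set" where
  "crossing_edges r N S = {e. e \<subseteq> N \<union> S \<and> card e = r \<and> e \<inter> N \<noteq> {} \<and> e \<inter> S \<noteq> {}}"

text \<open>\<open>H\<close> is star-like with nucleus vertex set \<open>N\<close> and set \<open>\<S>\<close> of satellite vertex sets.
  For \<open>r \<ge> 2\<close> the complete hypergraph on a singleton has no edges, so a single-vertex satellite
  needs no separate treatment of its edges. \<open>A S\<close> is the set of the \<open>k\<close> edges attaching
  \<open>S\<close>.\<close>

definition star_like :: "nat \<Rightarrow> nat \<Rightarrow> nat \<Rightarrow> 'a set \<Rightarrow> 'a set set \<Rightarrow> 'a hypergraph \<Rightarrow> bool" where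
  "star_like k l r N \<S> H \<longleftrightarrow>
     finite N \<and> card N = l - 1 \<and>
     finite \<S> \<and> disjoint \<S> \<and>
     (\<forall>S\<in>\<S>. finite S \<and> N \<inter> S = {} \<and> (card S = 1 \<or> r \<le> card S \<and> card S \<le> l - 1)) \<and>
     (\<exists>A. (\<forall>S\<in>\<S>. A S \<subseteq> crossing_edges r N S \<and> card (A S) = k) \<and>
          H = \<lparr>verts = N \<union> \<Union>\<S>,
               edges = complete_edges r N \<union> (\<Union>S\<in>\<S>. complete_edges r S \<union> A S)\<rparr>)"

text \<open>The multiset of the orders of the satellites, where \<open>n = p (l - 1) + q\<close>.\<close>

definition MSH_satellite_sizes :: "nat \<Rightarrow> nat \<Rightarrow> nat \<Rightarrow> nat \<Rightarrow> nat multiset" where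
  "MSH_satellite_sizes n k l r =
     (let p = n div (l - 1); q = n mod (l - 1); s = s_num k r in
      if l - 1 > s
      then replicate_mset (p - 1) (l - 1) + (if q > s then {#q#} else replicate_mset q 1)
      else replicate_mset (n - (l - 1)) 1)"

definition MSH :: "nat \<Rightarrow> nat \<Rightarrow> nat \<Rightarrow> nat \<Rightarrow> 'a hypergraph set" where
  "MSH n k l r =
     {H. \<exists>N \<S>. star_like k l r N \<S> H \<and>
            image_mset card (mset_set \<S>) = MSH_satellite_sizes n k l r}"

end

theory Submission
  imports Defs
begin

text \<open>Since a subhypergraph with at least \<open>l\<close> vertices is contained neither in the nucleus nor in
  a satellite, it is cut by the at most \<open>k\<close> edges attaching some satellite.

  Let now \<open>e\<close> be a missing edge. Induce \<open>H + e\<close> on the nucleus and the satellites that \<open>e\<close> meets.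
  If \<open>l - 1 > t\<close>, every part is a single vertex or, because \<open>s \<ge> t\<close>, is complete on more than \<open>t\<close>
  vertices, hence has edge-connectivity more than \<open>k\<close>. So only cuts along the parts matter. These
  contain \<open>k\<close> attaching edges of one satellite and, in addition, \<open>e\<close> or the attaching edges of
  another.

  If \<open>l - 1 = t\<close>, all satellites are single vertices, since \<open>t \<le> s\<close>. Let a cut have a satellite
  \<open>u\<close> and \<open>a < t\<close> vertices of the nucleus on one side. It contains at least \<open>a choose (r - 1)\<close>
  edges of the nucleus, and at most \<open>a choose (r - 1)\<close> edges at \<open>u\<close> escape it. This balance yields
  \<open>k\<close> edges, and one more except in a degenerate configuration.\<close>

section \<open>Cuts and edge-connectivity\<close>

text \<open>Formulated for a bare edge set, so that the complete parts and the attaching edges can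
  be counted separately. In a hypergraph \<open>\<not> e \<subseteq> X\<close> agrees with meeting
  the complement of \<open>X\<close>.\<close>

definition cut_edges :: "'a set set \<Rightarrow> 'a set \<Rightarrow> 'a set set" where
  "cut_edges E X = {e \<in> E. e \<inter> X \<noteq> {} \<and> \<not> e \<subseteq> X}"

lemma cut_edges_mono: "E \<subseteq> F \<Longrightarrow> cut_edges E X \<subseteq> cut_edges F X"
  by (auto simp: cut_edges_def)

lemma cut_edges_subset: "cut_edges E X \<subseteq> E"
  by (auto simp: cut_edges_def)

lemma finite_edges: "hypergraph H \<Longrightarrow> finite (edges H)"
  unfolding hypergraph_def by (meson Pow_iff finite_Pow_iff finite_subset subsetI)

lemma cut_degree_eq:
  assumes "hypergraph H"
  shows "cut_degree H X = card (cut_edges (edges H) X)"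
proof -
  have "{e \<in> edges H. e \<inter> X \<noteq> {} \<and> e \<inter> (verts H - X) \<noteq> {}} = cut_edges (edges H) X"
    using assms unfolding hypergraph_def cut_edges_def by blast
  then show ?thesis by (simp add: cut_degree_def)
qed

lemma cut_edges_compl:
  assumes "hypergraph H"
  shows "cut_edges (edges H) (verts H - X) = cut_edges (edges H) X"
  using assms unfolding hypergraph_def cut_edges_def by blast

lemma finite_cut_degrees:
  "hypergraph H \<Longrightarrow> finite (cut_degree H ` {X. X \<noteq> {} \<and> X \<subset> verts H})"
  unfolding hypergraph_def by (metis (no_types, lifting) finite_Collect_subsets finite_imageI
    finite_subset mem_Collect_eq psubset_imp_subset subsetI)

lemma edge_conn_le:
  assumes "hypergraph H" "X \<noteq> {}" "X \<subset> verts H" "card (cut_edges (edges H) X) \<le> m"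
  shows "edge_conn H \<le> m"
proof -
  have "edge_conn H \<le> cut_degree H X"
    unfolding edge_conn_def using assms finite_cut_degrees by (intro Min_le) auto
  then show ?thesis using assms cut_degree_eq by (metis le_trans)
qed

text \<open>Two vertices guarantee a nonempty proper vertex set, without which \<open>Min\<close>
  would have no specified value.\<close>

lemma edge_conn_ge:
  assumes "hypergraph H" "2 \<le> card (verts H)"
    and "\<And>X. X \<noteq> {} \<Longrightarrow> X \<subset> verts H \<Longrightarrow> m \<le> card (cut_edges (edges H) X)"
  shows "m \<le> edge_conn H"
proof -
  obtain v where v: "v \<in> verts H" using assms(2) by fastforce
  have "{v} \<noteq> verts H"
  proof
    assume "{v} = verts H"
    then have "card (verts H) = 1" by (metis is_singletonI is_singleton_altdef)
    then show False using assms(2) by simp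
  qed
  then have "{v} \<in> {X. X \<noteq> {} \<and> X \<subset> verts H}" using v by auto
  then have "cut_degree H ` {X. X \<noteq> {} \<and> X \<subset> verts H} \<noteq> {}" by blast
  then show ?thesis unfolding edge_conn_def
    using assms finite_cut_degrees[OF assms(1)] cut_degree_eq[OF assms(1)]
    by (subst Min_ge_iff) auto
qed

section \<open>Counting cut edges in a complete hypergraph and at a vertex\<close>

lemma finite_complete_edges: "finite W \<Longrightarrow> finite (complete_edges r W)"
  by (auto simp: complete_edges_def)

lemma card_complete_edges: "finite W \<Longrightarrow> card (complete_edges r W) = card W choose r"
  unfolding complete_edges_def by (rule n_subsets)

text \<open>A fixed vertex of \<open>W\<close> outside \<open>X\<close> completes each
  \<open>(r - 1)\<close>-subset of \<open>X \<inter> W\<close> to a cut edge. Since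
  \<open>r \<ge> 2\<close>, that subset is nonempty, so the edge does meet \<open>X\<close>.\<close>

lemma card_cut_complete_ge_choose:
  assumes "finite W" "\<not> W \<subseteq> X" "2 \<le> r"
  shows "card (X \<inter> W) choose (r - 1) \<le> card (cut_edges (complete_edges r W) X)"
proof -
  obtain z where z: "z \<in> W" "z \<notin> X" using assms by blast
  let ?F = "complete_edges (r - 1) (X \<inter> W)"
  have "inj_on (insert z) ?F"
    by (rule inj_onI) (metis (no_types, lifting) Diff_insert_absorb IntD1 complete_edges_def
        insert_absorb mem_Collect_eq subset_eq z(2) insert_Diff1 insert_iff insert_ident)
  moreover have "insert z ` ?F \<subseteq> cut_edges (complete_edges r W) X"
  proof
    fix g assume "g \<in> insert z ` ?F"
    then obtain f where f: "g = insert z f" "f \<subseteq> X \<inter> W" "card f = r - 1"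
      by (auto simp: complete_edges_def)
    have "finite f" using f assms finite_subset by blast
    moreover have "z \<notin> f" using f z by blast
    ultimately have "card g = r" using f assms by simp
    moreover have "f \<noteq> {}" using f assms by auto
    ultimately show "g \<in> cut_edges (complete_edges r W) X"
      using f z by (auto simp: cut_edges_def complete_edges_def)
  qed
  moreover have "finite (cut_edges (complete_edges r W) X)"
    using finite_complete_edges[OF assms(1)] cut_edges_subset finite_subset by metis
  ultimately have "card ?F \<le> card (cut_edges (complete_edges r W) X)"
    using card_inj_on_le by blast
  then show ?thesis using assms by (simp add: card_complete_edges)
qed

text \<open>An edge at \<open>u \<in> X\<close> that escapes the cut lies inside \<open>X\<close>,
  so removing \<open>u\<close> leaves an \<open>(r - 1)\<close>-subset of
  \<open>X \<inter> W\<close>. The loss is the same binomial that bounds the cut edges inside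
  \<open>W\<close> from below.\<close>

lemma card_le_cut_star_plus_choose:
  assumes "finite W" "u \<in> X" "u \<notin> W"
    and B: "\<And>f. f \<in> B \<Longrightarrow> f \<subseteq> insert u W \<and> card f = r \<and> u \<in> f"
  shows "card B \<le> card (cut_edges B X) + (card (X \<inter> W) choose (r - 1))"
proof -
  have finB: "finite B" using B assms(1) by (meson Pow_iff finite_Pow_iff finite_insert finite_subset subsetI)
  let ?D = "B - cut_edges B X"
  let ?F = "complete_edges (r - 1) (X \<inter> W)"
  have "inj_on (\<lambda>f. f - {u}) ?D"
    by (rule inj_onI) (metis B DiffD1 insert_Diff)
  moreover have "(\<lambda>f. f - {u}) ` ?D \<subseteq> ?F"
  proof
    fix g assume "g \<in> (\<lambda>f. f - {u}) ` ?D"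
    then obtain f where f: "g = f - {u}" "f \<in> B" "f \<notin> cut_edges B X" by blast
    have "f \<subseteq> X" using f B assms(2) by (auto simp: cut_edges_def)
    moreover have "card g = r - 1" using f B by simp
    ultimately show "g \<in> ?F" using f B[OF f(2)] by (auto simp: complete_edges_def)
  qed
  ultimately have "card ?D \<le> card ?F"
    using assms finite_complete_edges card_inj_on_le by (metis finite_Int)
  then have "card ?D \<le> card (X \<inter> W) choose (r - 1)"
    using assms by (simp add: card_complete_edges)
  moreover have "card B = card (cut_edges B X) + card ?D"
    using finB cut_edges_subset[of B X] by (metis card_Diff_subset card_mono finite_subset le_add_diff_inverse)
  ultimately show ?thesis by simp
qed

text \<open>Fix vertices y inside and z outside the cut. An edge at y that is not cut becomes one
  when y is replaced by z, so the cut is at least as large as the degree of y.\<close>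

lemma card_cut_complete_ge_degree:
  assumes "finite W" "W \<inter> X \<noteq> {}" "\<not> W \<subseteq> X" "2 \<le> r"
  shows "(card W - 1) choose (r - 1) \<le> card (cut_edges (complete_edges r W) X)"
proof -
  obtain y where y: "y \<in> W" "y \<in> X" using assms by blast
  obtain z where z: "z \<in> W" "z \<notin> X" using assms by blast
  let ?F = "complete_edges (r - 1) (W - {y})"
  define \<phi> where "\<phi> f = (if f \<subseteq> X then insert z f else insert y f)" for f
  have "inj_on \<phi> ?F"
  proof (rule inj_onI)
    fix f g assume "f \<in> ?F" "g \<in> ?F" and eq: "\<phi> f = \<phi> g"
    then have "y \<notin> f" "y \<notin> g" by (auto simp: complete_edges_def)
    moreover have "y \<noteq> z" using y z by blast
    ultimately show "f = g" using eq z unfolding \<phi>_def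
      by (auto split: if_splits)
  qed
  moreover have "\<phi> ` ?F \<subseteq> cut_edges (complete_edges r W) X"
  proof
    fix g assume "g \<in> \<phi> ` ?F"
    then obtain f where f: "g = \<phi> f" "f \<subseteq> W - {y}" "card f = r - 1"
      by (auto simp: complete_edges_def)
    have "finite f" using f assms finite_subset by blast
    moreover have "f \<noteq> {}" using f assms by auto
    moreover have "f \<subseteq> X \<Longrightarrow> z \<notin> f" "y \<notin> f" using f z by auto
    ultimately show "g \<in> cut_edges (complete_edges r W) X"
      using f y z assms by (auto simp: cut_edges_def complete_edges_def \<phi>_def)
  qed
  moreover have "finite (cut_edges (complete_edges r W) X)"
    using finite_complete_edges[OF assms(1)] cut_edges_subset finite_subset by metis
  ultimately have "card ?F \<le> card (cut_edges (complete_edges r W) X)"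
    using card_inj_on_le by blast
  then show ?thesis using assms y by (simp add: card_complete_edges)
qed

section \<open>A complete hypergraph with additional vertices\<close>

text \<open>On the side containing \<open>u\<close>, the edges at \<open>u\<close> that escape the
  cut are compensated by cut edges inside \<open>W\<close>. This serves for a missing edge meeting
  just one single-vertex satellite.\<close>

lemma edge_conn_complete_plus_vertex:
  assumes G: "hypergraph G" "verts G = insert u W" and "u \<notin> W" "W \<noteq> {}" "2 \<le> r"
    and "complete_edges r W \<subseteq> edges G" "B \<subseteq> edges G"
    and B: "\<And>f. f \<in> B \<Longrightarrow> card f = r \<and> u \<in> f"
  shows "card B \<le> edge_conn G"
proof (rule edge_conn_ge[OF G(1)])
  have finW: "finite W" using G unfolding hypergraph_def by simp
  have "0 < card W" using finW assms by (simp add: card_gt_0_iff)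
  then show "2 \<le> card (verts G)" using G assms(3) finW by simp
  have key: "card B \<le> card (cut_edges (edges G) X)" if "u \<in> X" "\<not> W \<subseteq> X" for X
  proof -
    have "card B \<le> card (cut_edges B X) + (card (X \<inter> W) choose (r - 1))"
      using that finW assms by (intro card_le_cut_star_plus_choose) (auto simp: hypergraph_def)
    also have "\<dots> \<le> card (cut_edges B X) + card (cut_edges (complete_edges r W) X)"
      using card_cut_complete_ge_choose finW that assms by simp
    also have "\<dots> = card (cut_edges B X \<union> cut_edges (complete_edges r W) X)"
    proof (intro card_Un_disjoint[symmetric])
      show "finite (cut_edges B X)" "finite (cut_edges (complete_edges r W) X)"
        using assms(6,7) finite_edges[OF G(1)] cut_edges_subset by (meson finite_subset)+
      show "cut_edges B X \<inter> cut_edges (complete_edges r W) X = {}"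
        using B assms(3) unfolding cut_edges_def complete_edges_def by blast
    qed
    also have "\<dots> \<le> card (cut_edges (edges G) X)"
      using assms finite_edges[OF G(1)]
      by (intro card_mono finite_subset[OF cut_edges_subset] Un_least cut_edges_mono)
    finally show ?thesis .
  qed
  fix X assume X: "X \<noteq> {}" "X \<subset> verts G"
  show "card B \<le> card (cut_edges (edges G) X)"
  proof (cases "u \<in> X")
    case True
    moreover have "\<not> W \<subseteq> X" using True X unfolding G(2) by blast
    ultimately show ?thesis by (rule key)
  next
    case False
    then have "card B \<le> card (cut_edges (edges G) (verts G - X))"
      using X G by (intro key) auto
    then show ?thesis using cut_edges_compl[OF G(1)] by simp
  qed
qed

text \<open>The balance at one vertex of \<open>U\<close> gives \<open>k\<close> cut edges, and
  \<open>e\<close> is one more if it is cut. Otherwise all of \<open>U\<close> lies on one side.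
  Assumption \<open>bad\<close> excludes the configuration in which \<open>e\<close> and all
  attaching edges also stay on that side and the guaranteed cut inside \<open>W\<close> is only
  \<open>k\<close>.\<close>

lemma edge_conn_complete_plus_vertices:
  assumes G: "hypergraph G" "verts G = W \<union> U" and WU: "W \<inter> U = {}" "W \<noteq> {}" and r: "2 \<le> r"
    and k: "2 \<le> k" and U: "2 \<le> card U"
    and W: "complete_edges r W \<subseteq> edges G"
    and B: "\<And>u. u \<in> U \<Longrightarrow> B u \<subseteq> edges G \<and> k \<le> card (B u)"
    and Bu: "\<And>u f. u \<in> U \<Longrightarrow> f \<in> B u \<Longrightarrow> f \<subseteq> insert u W \<and> card f = r \<and> u \<in> f"
    and e: "e \<in> edges G" "U \<subseteq> e"
    and bad: "\<And>Y. Y \<subset> W \<Longrightarrow> e \<subseteq> Y \<union> U \<Longrightarrow> (\<And>u f. u \<in> U \<Longrightarrow> f \<in> B u \<Longrightarrow> f \<subseteq> insert u Y) \<Longrightarrow>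
              card Y choose (r - 1) \<noteq> k"
  shows "k + 1 \<le> edge_conn G"
proof (rule edge_conn_ge[OF G(1)])
  have fin: "finite W" "finite U" using G unfolding hypergraph_def by simp_all
  have finE: "finite (edges G)" using finite_edges G by blast
  have "card U \<le> card (verts G)" using fin G by (simp add: card_mono)
  then show "2 \<le> card (verts G)" using U by simp
  have exother: "\<exists>v\<in>U. v \<noteq> u" for u
  proof (rule ccontr)
    assume "\<not> ?thesis" then have "U \<subseteq> {u}" by blast
    then have "card U \<le> 1" using card_mono[of "{u}" U] by simp
    then show False using U by simp
  qed
  have eW: "e \<notin> complete_edges r W" using e WU exother unfolding complete_edges_def by blast
  have eB: "e \<notin> B u" if "u \<in> U" for u
  proof
    assume "e \<in> B u"
    then have "e \<subseteq> insert u W" using Bu that by blast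
    then show False using exother[of u] e WU by blast
  qed
  have key: "k + 1 \<le> card (cut_edges (edges G) X)"
    if X: "X \<subseteq> verts G" "u \<in> U" "u \<in> X" "\<not> W \<subseteq> X" for X u
  proof -
    let ?c = "card (X \<inter> W) choose (r - 1)"
    let ?C = "cut_edges (edges G) X"
    let ?K = "cut_edges (complete_edges r W) X"
    have finC: "finite ?C" using finE finite_subset[OF cut_edges_subset] by blast
    have K: "?c \<le> card ?K" using card_cut_complete_ge_choose fin X r by blast
    have finK: "finite ?K" using finC cut_edges_mono[OF W] finite_subset by blast
    have S: "k \<le> card (cut_edges (B v) X) + ?c" if "v \<in> U" "v \<in> X" for v
      using card_le_cut_star_plus_choose[of W v X "B v" r] fin that WU Bu B
      by (meson disjoint_iff le_trans)
    have finS: "finite (cut_edges (B v) X)" if "v \<in> U" for v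
      using finC B that cut_edges_mono finite_subset by metis
    have KS: "?K \<inter> cut_edges (B v) X = {}" if "v \<in> U" for v
      using Bu[OF that] WU that by (auto simp: cut_edges_def complete_edges_def)
    have sub: "?K \<subseteq> ?C" "\<And>v. v \<in> U \<Longrightarrow> cut_edges (B v) X \<subseteq> ?C"
      using W B cut_edges_mono by metis+
    have c1: "card (?K \<union> cut_edges (B u) X) = card ?K + card (cut_edges (B u) X)"
      using finK finS KS X by (intro card_Un_disjoint) auto
    show ?thesis
    proof (cases "e \<subseteq> X")
      case False
      then have eC: "e \<in> ?C" using e X by (auto simp: cut_edges_def)
      have "card (insert e (?K \<union> cut_edges (B u) X)) = card (?K \<union> cut_edges (B u) X) + 1"
        using eW eB X finK finS by (subst card_insert_disjoint) (auto simp: cut_edges_def)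
      moreover have "card (insert e (?K \<union> cut_edges (B u) X)) \<le> card ?C"
        using eC sub X finC by (intro card_mono) auto
      ultimately show ?thesis using c1 K S[of u] X by linarith
    next
      case True
      then have UX: "U \<subseteq> X" using e by blast
      obtain v where v: "v \<in> U" "v \<noteq> u" using exother by blast
      \<comment> \<open>Below \<open>k\<close>, the stars at \<open>u\<close> and \<open>v\<close>
        together with \<open>W\<close> give \<open>?c + 2 * (k - ?c) > k\<close> cut edges. Above
        \<open>k\<close>, the edges inside \<open>W\<close> suffice. At equality, \<open>bad\<close>
        with \<open>Y = X \<inter> W\<close> supplies one cut attaching edge beyond those inside
        \<open>W\<close>.\<close>
      consider "?c < k" | "?c > k" | "?c = k" by linarith
      then show ?thesis
      proof cases
        case 1
        have "cut_edges (B u) X \<inter> cut_edges (B v) X = {}"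
          using Bu[OF v(1)] Bu[OF X(2)] v X(2) WU unfolding cut_edges_def by blast
        then have "card ((?K \<union> cut_edges (B u) X) \<union> cut_edges (B v) X) =
            card (?K \<union> cut_edges (B u) X) + card (cut_edges (B v) X)"
          using finK finS KS X v by (intro card_Un_disjoint) auto
        moreover have "card ((?K \<union> cut_edges (B u) X) \<union> cut_edges (B v) X) \<le> card ?C"
          using sub X v finC by (intro card_mono) auto
        ultimately show ?thesis using c1 K S[of u] S[of v] X v UX 1 by (smt (verit) add.commute
          add_le_mono le_trans nat_add_left_cancel_le subsetD less_eq_Suc_le Suc_eq_plus1 not_less_eq_eq)
      next
        case 2
        have "card ?K \<le> card ?C" using finC sub by (intro card_mono) auto
        then show ?thesis using 2 K by linarith
      next
        case 3
        have "X \<inter> W \<subset> W" "e \<subseteq> (X \<inter> W) \<union> U" using X True e G unfolding hypergraph_def by blast+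
        then obtain w f where f: "w \<in> U" "f \<in> B w" "\<not> f \<subseteq> insert w (X \<inter> W)"
          using bad 3 by blast
        have "f \<in> ?C" using f Bu[OF f(1,2)] B[OF f(1)] UX by (auto simp: cut_edges_def)
        moreover have "f \<notin> ?K"
          using Bu[OF f(1,2)] f(1) WU by (auto simp: cut_edges_def complete_edges_def)
        moreover have "card (insert f ?K) \<le> card ?C"
          using \<open>f \<in> ?C\<close> sub finC by (intro card_mono) auto
        ultimately show ?thesis using K 3 finK by simp
      qed
    qed
  qed
  fix X assume X: "X \<noteq> {}" "X \<subset> verts G"
  show "k + 1 \<le> card (cut_edges (edges G) X)"
  proof (cases "U \<inter> X \<noteq> {} \<and> \<not> W \<subseteq> X")
    case True
    then show ?thesis using key X by blast
  next
    case False
    \<comment> \<open>Either \<open>X\<close> misses \<open>U\<close>, and then it meets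
      \<open>W\<close>, or \<open>X\<close> contains \<open>W\<close>, and then it misses a vertex
      of \<open>U\<close>. In both cases the complement satisfies the conditions of
      \<open>key\<close>.\<close>
    then obtain u where "u \<in> U" "u \<in> verts G - X" using X G exother by blast
    moreover have "\<not> W \<subseteq> verts G - X" using False X G WU by blast
    ultimately have "k + 1 \<le> card (cut_edges (edges G) (verts G - X))"
      by (intro key) auto
    then show ?thesis using cut_edges_compl[OF G(1)] by simp
  qed
qed

section \<open>Binomial estimates and the numbers \<open>t\<close> and \<open>s\<close>\<close>

lemma choose_less_choose:
  assumes "a < b" "1 \<le> j" "j \<le> b"
  shows "a choose j < b choose j"
proof -
  obtain c i where ci: "b = Suc c" "j = Suc i" using assms by (metis One_nat_def Suc_le_D less_imp_Suc_add)
  have "a choose j \<le> c choose j" using assms ci by (intro binomial_right_mono) auto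
  moreover have "0 < c choose i" using assms ci by simp
  ultimately show ?thesis unfolding ci binomial_Suc_Suc by linarith
qed

text \<open>Starting from \<open>j choose j = 1\<close>, Pascal's rule adds at least one at each
  step. This makes the unboundedness behind \<open>t_num\<close> and \<open>s_num\<close>
  explicit.\<close>

lemma less_choose: "1 \<le> j \<Longrightarrow> m < (m + j) choose j"
proof (induction m)
  case (Suc m)
  then obtain i where i: "j = Suc i" by (metis One_nat_def Suc_le_D)
  have "0 < (m + j) choose i" using i by simp
  moreover have "m < (m + j) choose j" using Suc by blast
  ultimately show ?case unfolding i add_Suc binomial_Suc_Suc by linarith
qed simp

lemma t_num_bounds:
  assumes "2 \<le> r"
  shows "(t_num k r - 1) choose (r - 1) \<le> k" "k < t_num k r choose (r - 1)"
proof -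
  let ?P = "\<lambda>t. (t - 1) choose (r - 1) \<le> k \<and> k < t choose (r - 1)"
  have ex: "\<exists>m. k < m choose (r - 1)" using assms
    by (intro exI[of _ "k + (r - 1)"] less_choose) simp
  define t where "t = (LEAST m. k < m choose (r - 1))"
  have t: "k < t choose (r - 1)" unfolding t_def using ex by (rule LeastI_ex)
  \<comment> \<open>Rules out truncation in \<open>t - 1\<close>, which is therefore strictly below
    the least element.\<close>
  then have "t \<noteq> 0" using assms by (intro notI) (simp add: binomial_eq_0)
  then have "\<not> k < (t - 1) choose (r - 1)" unfolding t_def
    using not_less_Least t_def by (metis diff_less gr0I zero_less_one)
  then have "?P t" using t by simp
  moreover have "b \<le> a" if "?P a" "?P b" for a b
  proof (rule ccontr)
    assume "\<not> b \<le> a"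
    then have "a choose (r - 1) \<le> (b - 1) choose (r - 1)" by (intro binomial_right_mono) simp
    then show False using that by linarith
  qed
  ultimately have "\<exists>!t. ?P t" by (metis le_antisym)
  then have "?P (t_num k r)" unfolding t_num_def by (rule theI')
  then show "(t_num k r - 1) choose (r - 1) \<le> k" "k < t_num k r choose (r - 1)" by auto
qed

lemma t_num_ge:
  assumes "2 \<le> r" "1 \<le> k"
  shows "r \<le> t_num k r"
proof (rule ccontr)
  assume "\<not> ?thesis"
  then have "t_num k r choose (r - 1) \<le> (r - 1) choose (r - 1)" by (intro binomial_right_mono) simp
  then show False using t_num_bounds(2)[OF assms(1), of k] assms(2) by simp
qed

text \<open>By absorption,
  \<open>r * (t choose r) = t * ((t - 1) choose (r - 1)) \<le> t * k\<close>. As \<open>r\<close>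
  and \<open>t\<close> are at least 2, both \<open>t choose r\<close> and \<open>k\<close> are at
  most half of \<open>k * t\<close>.\<close>

lemma s_num_ge_t_num:
  assumes "2 \<le> r" "1 \<le> k"
  shows "t_num k r \<le> s_num k r"
proof -
  let ?P = "\<lambda>s. k + (s choose r) \<le> k * s" and ?t = "t_num k r"
  have absorb: "r * (s choose r) = s * ((s - 1) choose (r - 1))" for s
    using times_binomial_minus1_eq[of r s] assms by simp
  have t2: "2 \<le> ?t" using t_num_ge[OF assms] assms by simp
  have "2 * (?t choose r) \<le> r * (?t choose r)" using assms by simp
  also have "\<dots> \<le> ?t * k"
    unfolding absorb using t_num_bounds(1)[OF assms(1)] by simp
  finally have "2 * (?t choose r) \<le> k * ?t" by (simp add: mult.commute)
  moreover have "2 * k \<le> k * ?t" using t2 by simp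
  ultimately have "?P ?t" by linarith
  \<comment> \<open>\<open>GREATEST\<close> needs an upper bound: beyond this one, absorption yields
    \<open>k * s \<le> s choose r\<close>.\<close>
  moreover have "s \<le> r * k + r" if s: "?P s" for s
  proof (rule ccontr)
    assume "\<not> ?thesis"
    then have *: "r * k + (r - 1) \<le> s - 1" by simp
    have "r * k < (r * k + (r - 1)) choose (r - 1)" using assms by (intro less_choose) simp
    also have "\<dots> \<le> (s - 1) choose (r - 1)" using * by (intro binomial_right_mono)
    finally have "s * (r * k) \<le> r * (s choose r)" unfolding absorb by simp
    then have "r * (k * s) \<le> r * (s choose r)" by (simp add: ac_simps)
    then have "k * s \<le> s choose r" using assms by simp
    then show False using s assms by linarith
  qed
  ultimately show ?thesis unfolding s_num_def by (intro Greatest_le_nat) auto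
qed

section \<open>Induced subhypergraphs and star-like hypergraphs\<close>

definition induced :: "'a hypergraph \<Rightarrow> 'a set \<Rightarrow> 'a hypergraph" where
  "induced H V = \<lparr>verts = V, edges = {e \<in> edges H. e \<subseteq> V}\<rparr>"

lemma verts_induced [simp]: "verts (induced H V) = V"
  by (simp add: induced_def)

lemma edges_induced [simp]: "edges (induced H V) = {e \<in> edges H. e \<subseteq> V}"
  by (simp add: induced_def)

lemma verts_add_edge [simp]: "verts (add_edge H e) = verts H"
  by (simp add: add_edge_def)

lemma edges_add_edge [simp]: "edges (add_edge H e) = insert e (edges H)"
  by (simp add: add_edge_def)

lemma hypergraph_add_edge:
  "hypergraph H \<Longrightarrow> e \<subseteq> verts H \<Longrightarrow> e \<noteq> {} \<Longrightarrow> hypergraph (add_edge H e)"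
  by (auto simp: hypergraph_def)

lemma subhypergraph_induced:
  "hypergraph H \<Longrightarrow> V \<subseteq> verts H \<Longrightarrow> subhypergraph (induced H V) H"
  by (auto simp: hypergraph_def subhypergraph_def intro: finite_subset)

locale star_like_hypergraph =
  fixes k l r :: nat and N :: "'a set" and \<S> :: "'a set set" and A :: "'a set \<Rightarrow> 'a set set"
    and H :: "'a hypergraph"
  assumes k: "2 \<le> k" and r: "2 \<le> r" and rl: "r \<le> l - 1"
    and finN: "finite N" and cardN: "card N = l - 1"
    and finS: "finite \<S>" and disj: "disjoint \<S>"
    and sat: "\<And>S. S \<in> \<S> \<Longrightarrow> finite S \<and> N \<inter> S = {} \<and> S \<noteq> {} \<and> card S \<le> l - 1"
    and att: "\<And>S. S \<in> \<S> \<Longrightarrow> A S \<subseteq> crossing_edges r N S \<and> card (A S) = k"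
    and H: "H = \<lparr>verts = N \<union> \<Union>\<S>,
               edges = complete_edges r N \<union> (\<Union>S\<in>\<S>. complete_edges r S \<union> A S)\<rparr>"
begin

lemma verts_H: "verts H = N \<union> \<Union>\<S>"
  by (simp add: H)

lemma edges_H: "edges H = complete_edges r N \<union> (\<Union>S\<in>\<S>. complete_edges r S \<union> A S)"
  by (simp add: H)

lemma N_nonempty: "N \<noteq> {}"
  using cardN rl r by auto

lemma sat_disjoint: "S \<in> \<S> \<Longrightarrow> S' \<in> \<S> \<Longrightarrow> S \<noteq> S' \<Longrightarrow> S \<inter> S' = {}"
  using disj by (auto simp: disjoint_def)

lemma attaching_edge: "S \<in> \<S> \<Longrightarrow> f \<in> A S \<Longrightarrow> f \<subseteq> N \<union> S \<and> card f = r \<and> f \<inter> N \<noteq> {} \<and> f \<inter> S \<noteq> {}"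
  using att unfolding crossing_edges_def by blast

lemma attaching_disjoint:
  assumes "S \<in> \<S>" "S' \<in> \<S>" "S \<noteq> S'"
  shows "A S \<inter> A S' = {}"
proof -
  have "f \<notin> A S'" if "f \<in> A S" for f
    using attaching_edge[OF assms(1) that] attaching_edge[OF assms(2), of f]
      sat_disjoint[OF assms] sat[OF assms(1)] by blast
  then show ?thesis by blast
qed

lemma finite_attaching: "S \<in> \<S> \<Longrightarrow> finite (A S)"
  using att k by (metis card.infinite not_numeral_le_zero)

lemma uniform_H: "uniform r H"
  using attaching_edge by (auto simp: uniform_def edges_H complete_edges_def)

lemma hypergraph_H: "hypergraph H"
proof -
  have "e \<noteq> {}" if "e \<in> edges H" for e
    using uniform_H r that by (force simp: uniform_def)
  moreover have "e \<subseteq> verts H" if "e \<in> edges H" for e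
    using that attaching_edge unfolding edges_H verts_H complete_edges_def by fast
  moreover have "finite (verts H)" using finN finS sat by (simp add: verts_H)
  ultimately show ?thesis by (simp add: hypergraph_def)
qed

text \<open>No part has \<open>l\<close> vertices, so some satellite \<open>S\<close> cuts
  \<open>H'\<close> properly. An edge meeting \<open>S\<close> without lying inside it can only
  belong to \<open>A S\<close>.\<close>

lemma edge_conn_sub_le:
  assumes H': "subhypergraph H' H" "l \<le> card (verts H')"
  shows "edge_conn H' \<le> k"
proof -
  have hyp: "hypergraph H'" and fin: "finite (verts H')"
    using H' by (auto simp: subhypergraph_def hypergraph_def)
  have "\<not> verts H' \<subseteq> N" using H' cardN card_mono[OF finN, of "verts H'"] r rl by linarith
  then obtain S where S: "S \<in> \<S>" "verts H' \<inter> S \<noteq> {}"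
    using H' unfolding subhypergraph_def verts_H by blast
  have "\<not> verts H' \<subseteq> S" using H' card_mono[of S "verts H'"] sat[OF S(1)] r rl by linarith
  moreover have "cut_edges (edges H') (verts H' \<inter> S) \<subseteq> A S"
  proof
    fix f assume "f \<in> cut_edges (edges H') (verts H' \<inter> S)"
    then have f: "f \<in> edges H" "f \<inter> S \<noteq> {}" "\<not> f \<subseteq> S"
      using H' hyp unfolding cut_edges_def subhypergraph_def hypergraph_def by blast+
    have "f \<notin> complete_edges r N" using f sat[OF S(1)] by (auto simp: complete_edges_def)
    moreover have "f \<notin> complete_edges r S'" if "S' \<in> \<S>" for S'
      using f sat_disjoint[OF S(1) that] by (auto simp: complete_edges_def)
    moreover have "S' = S" if "S' \<in> \<S>" "f \<in> A S'" for S'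
      using f sat_disjoint[OF S(1) that(1)] attaching_edge[OF that] sat[OF S(1)] by blast
    ultimately show "f \<in> A S" using f(1) unfolding edges_H by blast
  qed
  then have "card (cut_edges (edges H') (verts H' \<inter> S)) \<le> k"
    using att[OF S(1)] finite_attaching[OF S(1)] card_mono by metis
  ultimately show ?thesis using S hyp by (intro edge_conn_le[of H' "verts H' \<inter> S"]) blast+
qed

text \<open>\<open>Nk\<close> and \<open>Sk\<close> say that vertex degrees inside the nucleus and
  inside each larger satellite exceed \<open>k\<close>, so a cut splitting one of these parts is
  large enough. The other cuts are unions of parts; passing to the complement if necessary, they
  avoid the nucleus.\<close>

lemma edge_conn_add_edge_large:
  assumes e: "e \<subseteq> verts H" "card e = r" "e \<notin> edges H"
    and Nk: "k < (l - 2) choose (r - 1)"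
    and Sk: "\<And>S. S \<in> \<S> \<Longrightarrow> card S = 1 \<or> k < (card S - 1) choose (r - 1)"
  shows "\<exists>H''. subhypergraph H'' (add_edge H e) \<and> l \<le> card (verts H'') \<and> k + 1 \<le> edge_conn H''"
proof -
  define T where "T = {S \<in> \<S>. S \<inter> e \<noteq> {}}"
  define G where "G = induced (add_edge H e) (N \<union> \<Union>T)"
  have TS: "T \<subseteq> \<S>" by (auto simp: T_def)
  have e0: "e \<noteq> {}" using e r by auto
  have eT: "e \<subseteq> N \<union> \<Union>T" using e by (auto simp: T_def verts_H)
  have vG: "verts G = N \<union> \<Union>T" by (simp add: G_def)
  have sub: "subhypergraph G (add_edge H e)" unfolding G_def
    using hypergraph_add_edge[OF hypergraph_H e(1) e0] TS
    by (intro subhypergraph_induced) (auto simp: verts_H)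
  then have hG: "hypergraph G" by (simp add: subhypergraph_def)
  have finV: "finite (verts G)" using hG by (simp add: hypergraph_def)
  have eN: "\<not> e \<subseteq> N" using e by (auto simp: edges_H complete_edges_def)
  have eS: "\<not> e \<subseteq> S" if "S \<in> \<S>" for S using e that by (auto simp: edges_H complete_edges_def)
  \<comment> \<open>Every part is complete, so the missing edge lies in none of them. Hence it meets
    a satellite, which lifts the order of \<open>G\<close> above \<open>l - 1\<close>.\<close>
  obtain S0 where S0: "S0 \<in> T" using eN eT by blast
  have "N \<subset> verts G" using S0 TS sat[of S0] unfolding vG by blast
  then have "l - 1 < card (verts G)" using psubset_card_mono[OF finV] cardN by metis
  then have cV: "l \<le> card (verts G)" by simp
  have eG: "e \<in> edges G" using eT by (simp add: G_def)
  have NG: "complete_edges r N \<subseteq> edges G" by (auto simp: G_def edges_H complete_edges_def)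
  have SG: "complete_edges r S \<subseteq> edges G" "A S \<subseteq> edges G" if "S \<in> T" for S
    using that TS attaching_edge[of S] by (auto simp: G_def edges_H complete_edges_def) blast+
  have eA: "e \<notin> A S" if "S \<in> T" for S using that TS e by (auto simp: edges_H)
  have finC: "finite (cut_edges (edges G) X)" for X
    using finite_edges[OF hG] cut_edges_subset finite_subset by metis
  have split: "k + 1 \<le> card (cut_edges (edges G) X)"
    if "complete_edges r W \<subseteq> edges G" "finite W" "k < (card W - 1) choose (r - 1)"
      "W \<inter> X \<noteq> {}" "\<not> W \<subseteq> X" for W X
  proof -
    have "k < card (cut_edges (complete_edges r W) X)"
      using card_cut_complete_ge_degree[OF that(2,4,5) r] that(3) by linarith
    also have "\<dots> \<le> card (cut_edges (edges G) X)"
      using that(1) finC by (intro card_mono cut_edges_mono)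
    finally show ?thesis by simp
  qed
  have key: "k + 1 \<le> card (cut_edges (edges G) X)"
    if X: "X \<noteq> {}" "X \<subseteq> verts G" "N \<inter> X = {}" for X
  proof (cases "\<exists>S\<in>T. S \<inter> X \<noteq> {} \<and> \<not> S \<subseteq> X")
    case True
    then obtain S where S: "S \<in> T" "S \<inter> X \<noteq> {}" "\<not> S \<subseteq> X" by blast
    then have "card S \<noteq> 1" by (auto simp: card_1_singleton_iff)
    then have "k < (card S - 1) choose (r - 1)" "finite S" using Sk sat S TS by blast+
    then show ?thesis using S SG by (intro split[of S]) blast+
  next
    case False
    let ?C = "cut_edges (edges G) X"
    have AC: "A S \<subseteq> ?C" if "S \<in> T" "S \<subseteq> X" for S
    proof
      fix f assume f: "f \<in> A S"
      have "S \<in> \<S>" using that TS by blast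
      then show "f \<in> ?C" using attaching_edge[OF _ f] SG(2)[OF that(1)] f that(2) X(3)
        unfolding cut_edges_def by blast
    qed
    have cA: "card (A S) = k" "finite (A S)" if "S \<in> T" for S
      using att finite_attaching TS that by auto
    obtain x where x: "x \<in> X" using X(1) by blast
    then obtain S where "S \<in> T" "x \<in> S" using X(2,3) unfolding vG by blast
    then have S: "S \<in> T" "S \<subseteq> X" using x False by blast+
    have "?thesis" if "e \<in> ?C"
    proof -
      have "card (insert e (A S)) \<le> card ?C"
        using that AC[OF S] finC by (intro card_mono) auto
      then show ?thesis using cA[OF S(1)] eA[OF S(1)] by simp
    qed
    moreover have "e \<in> ?C" if "\<not> e \<subseteq> X"
      using that eG S unfolding cut_edges_def T_def by blast
    \<comment> \<open>Here \<open>e\<close> avoids the nucleus and is not inside \<open>S\<close>,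
      so it meets a second satellite in \<open>X\<close>. Two disjoint attaching sets give
      \<open>2 * k \<ge> k + 1\<close> cut edges.\<close>
    moreover have ?thesis if eX: "e \<subseteq> X"
    proof -
      have "\<not> e \<subseteq> S" using eS S TS by blast
      then obtain x where x: "x \<in> e" "x \<notin> S" by blast
      then obtain S' where S': "S' \<in> T" "x \<in> S'" using eT eX X(3) by blast
      then have "S' \<subseteq> X" using False x eX by blast
      have "S' \<noteq> S" using S' x by blast
      then have "card (A S \<union> A S') = 2 * k"
        using attaching_disjoint[of S S'] S S' TS cA by (subst card_Un_disjoint) auto
      moreover have "card (A S \<union> A S') \<le> card ?C"
        using AC S S' \<open>S' \<subseteq> X\<close> finC by (intro card_mono) auto
      ultimately show ?thesis using k by linarith
    qed
    ultimately show ?thesis by blast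
  qed
  have "k + 1 \<le> edge_conn G"
  proof (rule edge_conn_ge[OF hG])
    show "2 \<le> card (verts G)" using cV r rl by linarith
    fix X assume X: "X \<noteq> {}" "X \<subset> verts G"
    consider "N \<inter> X = {}" | "N \<inter> X \<noteq> {}" "\<not> N \<subseteq> X" | "N \<subseteq> X" by blast
    then show "k + 1 \<le> card (cut_edges (edges G) X)"
    proof cases
      case 1
      then show ?thesis using key X by blast
    next
      case 2
      then show ?thesis using NG finN Nk cardN by (intro split[of N]) (auto simp: numeral_2_eq_2)
    next
      case 3
      then have "k + 1 \<le> card (cut_edges (edges G) (verts G - X))"
        using X by (intro key) auto
      then show ?thesis using cut_edges_compl[OF hG] by simp
    qed
  qed
  then show ?thesis using sub cV by blast
qed

text \<open>Here the nucleus need not be highly connected. If e meets at least two satellites, the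
  subhypergraph induced by the nucleus and these satellites can fail only when all their
  attaching edges, and e, avoid some vertex of the nucleus; then that vertex is dropped.\<close>

lemma edge_conn_add_edge_small:
  assumes e: "e \<subseteq> verts H" "card e = r" "e \<notin> edges H"
    and Nk: "(l - 2) choose (r - 1) \<le> k"
    and S1: "\<And>S. S \<in> \<S> \<Longrightarrow> card S = 1"
  shows "\<exists>H''. subhypergraph H'' (add_edge H e) \<and> l \<le> card (verts H'') \<and> k + 1 \<le> edge_conn H''"
proof -
  define U where "U = e - N"
  have e0: "e \<noteq> {}" using e r by auto
  have fine: "finite e" using e r by (metis card.infinite not_numeral_le_zero)
  have hA: "hypergraph (add_edge H e)" by (rule hypergraph_add_edge[OF hypergraph_H e(1) e0])
  have US: "{u} \<in> \<S>" if u: "u \<in> U" for u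
  proof -
    obtain S where S: "S \<in> \<S>" "u \<in> S" using u e by (auto simp: U_def verts_H)
    then have "S = {u}" using S1 by (auto simp: card_1_singleton_iff)
    then show ?thesis using S by simp
  qed
  have "\<not> e \<subseteq> N" using e by (auto simp: edges_H complete_edges_def)
  then have U0: "U \<noteq> {}" by (auto simp: U_def)
  have finU: "finite U" using fine by (simp add: U_def)
  have UN: "N \<inter> U = {}" by (auto simp: U_def)
  define B where "B u = A {u}" for u
  have B: "f \<subseteq> insert u N \<and> card f = r \<and> u \<in> f" if "u \<in> U" "f \<in> B u" for u f
    using attaching_edge[OF US[OF that(1)]] that by (auto simp: B_def)
  have Bk: "card (B u) = k" "B u \<subseteq> edges H" "finite (B u)" if "u \<in> U" for u
    using att US[OF that] finite_attaching by (auto simp: B_def edges_H)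
  define G where "G W = induced (add_edge H e) (W \<union> U)" for W
  have vG: "verts (G W) = W \<union> U" for W by (simp add: G_def)
  have sub: "subhypergraph (G W) (add_edge H e)" if "W \<subseteq> N" for W unfolding G_def
    using hA that e by (intro subhypergraph_induced) (auto simp: verts_H U_def)
  have hG: "hypergraph (G W)" if "W \<subseteq> N" for W using sub[OF that] by (simp add: subhypergraph_def)
  have WG: "complete_edges r W \<subseteq> edges (G W)" if "W \<subseteq> N" for W
    using that by (auto simp: G_def edges_H complete_edges_def)
  have cG: "card (verts (G W)) = card W + card U" if "W \<subseteq> N" for W
    unfolding vG using that UN finN finU by (intro card_Un_disjoint) (auto intro: finite_subset)
  have cU: "1 \<le> card U" using U0 finU by (simp add: Suc_leI card_gt_0_iff)
  consider u where "U = {u}" | "2 \<le> card U"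
    using cU by (metis One_nat_def card_1_singletonE le_antisym not_less_eq_eq numeral_2_eq_2)
  then show ?thesis
  proof cases
    case 1
    \<comment> \<open>The new edge counts as one more edge at \<open>u\<close>, giving
      \<open>k + 1\<close> in all.\<close>
    have "insert e (B u) \<subseteq> edges (G N)"
      using 1 B[of u] Bk[of u] by (auto simp: G_def U_def)
    then have "card (insert e (B u)) \<le> edge_conn (G N)"
      using 1 UN r N_nonempty WG[of N] hG[of N] B e
      by (intro edge_conn_complete_plus_vertex[of "G N" u N r]) (auto simp: vG U_def)
    moreover have "e \<notin> B u" using Bk[of u] 1 e by auto
    ultimately have "k + 1 \<le> edge_conn (G N)" using Bk[of u] 1 by simp
    moreover have "l \<le> card (verts (G N))" using cG[of N] cardN cU by simp
    ultimately show ?thesis using sub[of N] by blast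
  next
    case 2
    \<comment> \<open>For such \<open>Y\<close>, the cut of \<open>G N\<close> along
      \<open>Y \<union> U\<close> consists of edges of the nucleus alone, and the lower bound for
      these is exactly \<open>k\<close>.\<close>
    define bad where "bad Y \<longleftrightarrow> e \<subseteq> Y \<union> U \<and> (\<forall>u\<in>U. \<forall>f\<in>B u. f \<subseteq> insert u Y) \<and>
        card Y choose (r - 1) = k" for Y
    have main: "k + 1 \<le> edge_conn (G W)"
      if W: "W \<subseteq> N" "W \<noteq> {}" "e \<subseteq> W \<union> U" "\<And>u f. u \<in> U \<Longrightarrow> f \<in> B u \<Longrightarrow> f \<subseteq> insert u W"
        and nb: "\<And>Y. Y \<subset> W \<Longrightarrow> \<not> bad Y" for W
    proof (rule edge_conn_complete_plus_vertices[where W = W and U = U and r = r and B = B and e = e])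
      show "B u \<subseteq> edges (G W) \<and> k \<le> card (B u)" if "u \<in> U" for u
        using W(4)[OF that] Bk[OF that] that by (auto simp: G_def)
      show "f \<subseteq> insert u W \<and> card f = r \<and> u \<in> f" if "u \<in> U" "f \<in> B u" for u f
        using W(4)[OF that] B[OF that] by blast
      show "card Y choose (r - 1) \<noteq> k"
        if "Y \<subset> W" "e \<subseteq> Y \<union> U" "\<And>u f. u \<in> U \<Longrightarrow> f \<in> B u \<Longrightarrow> f \<subseteq> insert u Y" for Y
        using nb[OF that(1)] that(2,3) unfolding bad_def by blast
      show "W \<inter> U = {}" using W UN by blast
      show "e \<in> edges (G W)" using W by (simp add: G_def)
      show "U \<subseteq> e" by (auto simp: U_def)
    qed (use W hG WG vG k r 2 in auto)
    show ?thesis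
    proof (cases "\<exists>Y. Y \<subset> N \<and> bad Y")
      case False
      have "k + 1 \<le> edge_conn (G N)"
      proof (rule main)
        show "e \<subseteq> N \<union> U" by (auto simp: U_def)
        show "f \<subseteq> insert u N" if "u \<in> U" "f \<in> B u" for u f using B[OF that] by simp
        show "\<not> bad Y" if "Y \<subset> N" for Y using False that by blast
      qed (simp_all add: N_nonempty)
      moreover have "l \<le> card (verts (G N))" using cG[of N] cardN cU by simp
      ultimately show ?thesis using sub[of N] by blast
    next
      case True
      then obtain Y where Y: "Y \<subset> N" "bad Y" by blast
      have YN: "Y \<subseteq> N" using Y by blast
      have cY: "card Y choose (r - 1) = k" using Y by (simp add: bad_def)
      then have rY: "r - 1 \<le> card Y" using k by (metis binomial_eq_0_iff not_le not_numeral_le_zero)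
      have finY: "finite Y" using YN finN finite_subset by blast
      \<comment> \<open>The binomial is strictly increasing up to \<open>card Y\<close>, so two
        nested sets cannot both attain \<open>k\<close>. Hence \<open>main\<close> applies to
        \<open>Y\<close> itself.\<close>
      have "\<not> bad Z" if "Z \<subset> Y" for Z
      proof
        assume "bad Z"
        moreover have "card Z < card Y" using that finY psubset_card_mono by blast
        ultimately show False
          using choose_less_choose[of "card Z" "card Y" "r - 1"] rY cY r unfolding bad_def by linarith
      qed
      moreover have "Y \<noteq> {}" using rY r by auto
      ultimately have "k + 1 \<le> edge_conn (G Y)"
        using Y YN unfolding bad_def[of Y] by (intro main) blast+
      \<comment> \<open>A smaller \<open>Y\<close> would give
        \<open>k < (l - 2) choose (r - 1)\<close>, against \<open>Nk\<close>. The at least two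
        vertices of \<open>U\<close> then bring the order up to \<open>l\<close>.\<close>
      moreover have "l - 2 \<le> card Y"
      proof (rule ccontr)
        assume "\<not> ?thesis"
        then have "card Y choose (r - 1) < (l - 2) choose (r - 1)"
          using rl r by (intro choose_less_choose) auto
        then show False using cY Nk by simp
      qed
      then have "l \<le> card (verts (G Y))" using cG[OF YN] 2 by simp
      ultimately show ?thesis using sub[OF YN] by blast
    qed
  qed
qed

end

section \<open>Edge-maximality of the hypergraphs in \<open>MSH\<close>\<close>

text \<open>The orders other than 1 are \<open>l - 1\<close> and \<open>q\<close>, used only when
  they exceed \<open>s\<close>. With \<open>t \<le> s\<close>, this makes every larger satellite
  highly connected.\<close>

lemma MSH_satellite_sizes_cases:
  assumes "x \<in># MSH_satellite_sizes n k l r"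
  shows "x = 1 \<or> (s_num k r < l - 1 \<and> s_num k r < x)"
  using assms by (auto simp: MSH_satellite_sizes_def Let_def split: if_splits)

theorem theorem3p3:
  fixes n k l r :: nat and H :: "'a hypergraph"
  assumes "k \<ge> 2" and "r \<ge> 2"
    and "n \<ge> l" and "l \<ge> t_num k r + 1"
    and "H \<in> MSH n k l r"
  shows "edge_maximal k l r H"
proof -
  obtain N \<S> where star: "star_like k l r N \<S> H"
    and sizes: "image_mset card (mset_set \<S>) = MSH_satellite_sizes n k l r"
    using assms(5) by (auto simp: MSH_def)
  then obtain A where sl: "finite N" "card N = l - 1" "finite \<S>" "disjoint \<S>"
      "\<And>S. S \<in> \<S> \<Longrightarrow> finite S \<and> N \<inter> S = {} \<and> (card S = 1 \<or> r \<le> card S \<and> card S \<le> l - 1)"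
      "\<And>S. S \<in> \<S> \<Longrightarrow> A S \<subseteq> crossing_edges r N S \<and> card (A S) = k"
      "H = \<lparr>verts = N \<union> \<Union>\<S>,
            edges = complete_edges r N \<union> (\<Union>S\<in>\<S>. complete_edges r S \<union> A S)\<rparr>"
    unfolding star_like_def by blast
  let ?t = "t_num k r" and ?s = "s_num k r"
  have t: "?t \<le> l - 1" "r \<le> ?t" "?t \<le> ?s" using assms t_num_ge s_num_ge_t_num by auto
  interpret star_like_hypergraph k l r N \<S> A H
  proof
    show "finite S \<and> N \<inter> S = {} \<and> S \<noteq> {} \<and> card S \<le> l - 1" if "S \<in> \<S>" for S
      using sl(5)[OF that] assms t by auto
  qed (use assms sl t in auto)
  have large: "k < m choose (r - 1)" if "?t \<le> m" for m
    using t_num_bounds(2)[OF assms(2), of k] binomial_right_mono[OF that] by (meson less_le_trans)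
  have card_sat: "card S = 1 \<or> (?s < l - 1 \<and> ?s < card S)" if "S \<in> \<S>" for S
  proof -
    have "card S \<in># MSH_satellite_sizes n k l r"
      unfolding sizes[symmetric] using that finS by simp
    then show ?thesis by (rule MSH_satellite_sizes_cases)
  qed
  have "\<exists>H''. subhypergraph H'' (add_edge H e) \<and> card (verts H'') \<ge> l \<and> edge_conn H'' \<ge> k + 1"
    if e: "e \<subseteq> verts H" "card e = r" "e \<notin> edges H" for e
  proof (cases "l - 1 = ?t")
    case True
    then have "l - 2 = ?t - 1" by simp
    then have "(l - 2) choose (r - 1) \<le> k" using t_num_bounds(1)[OF assms(2)] by simp
    \<comment> \<open>Since \<open>l - 1 = ?t \<le> ?s\<close>, the alternative
      \<open>?s < l - 1\<close> is impossible.\<close>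
    moreover have "card S = 1" if "S \<in> \<S>" for S using card_sat[OF that] True t by simp
    ultimately show ?thesis using edge_conn_add_edge_small[OF e] by blast
  next
    case False
    then have "k < (l - 2) choose (r - 1)" using t by (intro large) simp
    \<comment> \<open>For a larger satellite, \<open>card S - 1 \<ge> ?s \<ge> ?t\<close>, so
      \<open>large\<close> applies.\<close>
    moreover have "card S = 1 \<or> k < (card S - 1) choose (r - 1)" if "S \<in> \<S>" for S
      using card_sat[OF that] t large[of "card S - 1"] by linarith
    ultimately show ?thesis using edge_conn_add_edge_large[OF e] by blast
  qed
  then show ?thesis
    using hypergraph_H uniform_H edge_conn_sub_le by (auto simp: edge_maximal_def)
qed

end
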